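(* Consider the single-machine scheduling problem with unit weights (minimize $\sum_j C_j$) in the non-clairvoyant kill-and-restart model. For every integer $n\geq 3$, no deterministic non-clairvoyant kill-and-restart strategy achieves a competitive ratio smaller than $3-\frac{2}{n+1}$ on instances with $n$ jobs; that is, for every deterministic non-clairvoyant kill-and-restart strategy $A$ and every $c<3-\frac{2}{n+1}$ there is an instance with $n$ unit-weight jobs, all with processing times $p_j\geq 1$, such that $A(I)>c\cdot \mathrm{OPT}(I)$.
   Context: An instance consists of $n$ jobs $j\in[n]$ with processing times $p_j>0$ (and here unit weights), to be processed on a single machine; the objective is $\sum_j C_j$, where $C_j$ is the completion time of job $j$. $\mathrm{OPT}(I)$ is the optimal (clairvoyant) objective value, attained by processing the jobs non-preemptively in nondecreasing order of processing time. Non-clairvoyant: $p_j$ is unknown to the strategy until job $j$ completes. Kill-and-restart strategy: the strategy chooses probings $(t,j,\tau)$ of unfinished jobs $j$ starting at time $t$ for probing time $\tau\in(0,\infty]$, with at most one probing running at any time; if $\tau\geq p_j$ the job completes at time $t+p_j$, otherwise the probing ends at time $t+\tau$, the job is aborted and all its progress is lost (a later probing has to run it from the beginning). Decisions may depend only on information revealed so far (which jobs completed and when, and that failed probings were shorter than the corresponding processing times). Strategies may use infinitely many probings. $A(I)$ denotes the objective value of the schedule produced by $A$ on $I$; $A$ is $c$-competitive if $A(I)\leq c\cdot\mathrm{OPT}(I)$ for all instances $I$, and its competitive ratio is the infimum of such $c$. *)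

theory Defs
  imports Complex_Main "HOL-Library.Extended_Real"
begin

text \<open>
  The jobs of an instance are the elements of \<open>{..<n}\<close>, with processing times \<open>p j > 0\<close>.
  All weights are 1.

  A probing is a triple of a start time, a job and a probing time \<open>\<tau> \<in> (0,\<infinity>]\<close>.
  A history lists the completed jobs with their completion times, latest first.
\<close>

type_synonym probing = "real \<times> nat \<times> ereal"
type_synonym history = "(nat \<times> real) list"

definition is_instance :: "nat \<Rightarrow> (nat \<Rightarrow> real) \<Rightarrow> bool" where
  "is_instance n p \<longleftrightarrow> (\<forall>j<n. 0 < p j)"

definition now :: "history \<Rightarrow> real" where
  "now h = (case h of [] \<Rightarrow> 0 | (j, C) # _ \<Rightarrow> C)"

text \<open>
  A plan is what the machine is going to do from the current time on, until the next job completes.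
  It may contain infinitely many probings, with any accumulation points of their start times
  (e.g. infinitely many shorter and shorter probings right after the current time).
\<close>

definition valid_plan :: "nat \<Rightarrow> history \<Rightarrow> probing set \<Rightarrow> bool" where
  "valid_plan n h P \<longleftrightarrow>
     (\<forall>(t, j, \<tau>) \<in> P. j < n \<and> j \<notin> fst ` set h \<and> now h \<le> t \<and> 0 < \<tau>) \<and>
     (\<forall>(t, j, \<tau>) \<in> P. \<forall>(t', j', \<tau>') \<in> P. (t, j, \<tau>) \<noteq> (t', j', \<tau>') \<longrightarrow>
        ereal t + \<tau> \<le> ereal t' \<or> ereal t' + \<tau>' \<le> ereal t)"

text \<open>
  A deterministic strategy makes a new plan at time 0 and whenever a job completes.
  This loses no generality: between two completions the only information revealed is that the
  probings ended so far have failed. As long as no job completes, this is known in advance, so a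
  reaction to it can be made part of the plan. Nor is any information withheld: the processing time
  of a completed job and the failed probings are determined by the history and the (fixed) strategy.
\<close>

type_synonym strategy = "history \<Rightarrow> probing set"

definition kill_restart_strategy :: "nat \<Rightarrow> strategy \<Rightarrow> bool" where
  "kill_restart_strategy n A \<longleftrightarrow> (\<forall>h. valid_plan n h (A h))"

definition first_success :: "(nat \<Rightarrow> real) \<Rightarrow> probing set \<Rightarrow> real \<Rightarrow> nat \<Rightarrow> bool" where
  "first_success p P t j \<longleftrightarrow>
     (\<exists>\<tau>. (t, j, \<tau>) \<in> P \<and> ereal (p j) \<le> \<tau>) \<and>
     (\<forall>(t', j', \<tau>') \<in> P. ereal (p j') \<le> \<tau>' \<longrightarrow> t \<le> t')"

text \<open>
  The histories that occur when strategy \<open>A\<close> is run on processing times \<open>p\<close>. If a valid plan contains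
  a successful probing, then it contains a first one: successful probings do not overlap and their
  lengths are bounded away from 0.
\<close>

inductive run :: "strategy \<Rightarrow> (nat \<Rightarrow> real) \<Rightarrow> history \<Rightarrow> bool"
  for A :: strategy and p :: "nat \<Rightarrow> real" where
  start: "run A p []"
| complete: "run A p h \<Longrightarrow> first_success p (A h) t j \<Longrightarrow> run A p ((j, t + p j) # h)"

text \<open>The infimum ranges over at most one value; it is \<open>\<infinity>\<close> if the job never completes.\<close>

definition completion_time :: "strategy \<Rightarrow> (nat \<Rightarrow> real) \<Rightarrow> nat \<Rightarrow> ereal" where
  "completion_time A p j = Inf {ereal C | C. \<exists>h. run A p h \<and> (j, C) \<in> set h}"

definition cost :: "nat \<Rightarrow> strategy \<Rightarrow> (nat \<Rightarrow> real) \<Rightarrow> ereal" where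
  "cost n A p = (\<Sum>j<n. completion_time A p j)"

text \<open>
  The clairvoyant optimum: the strategy may be chosen with knowledge of \<open>p\<close>. By lemma
  \<open>OPT_eq_SPT\<close> below, it is attained by processing the jobs non-preemptively in
  nondecreasing order of processing time.
\<close>

definition OPT :: "nat \<Rightarrow> (nat \<Rightarrow> real) \<Rightarrow> ereal" where
  "OPT n p = (INF A \<in> {A. kill_restart_strategy n A}. cost n A p)"

definition competitive :: "nat \<Rightarrow> real \<Rightarrow> strategy \<Rightarrow> bool" where
  "competitive n c A \<longleftrightarrow> (\<forall>p. is_instance n p \<longrightarrow> cost n A p \<le> ereal c * OPT n p)"

definition competitive_ratio :: "nat \<Rightarrow> strategy \<Rightarrow> ereal" where
  "competitive_ratio n A = Inf {ereal c | c. competitive n c A}"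


lemma first_success_unique:
  assumes "valid_plan n h P" "first_success p P t j" "first_success p P t' j'"
  shows "t = t' \<and> j = j'"
proof -
  obtain \<tau> where a: "(t, j, \<tau>) \<in> P" "ereal (p j) \<le> \<tau>"
    using assms(2) unfolding first_success_def by blast
  obtain \<tau>' where b: "(t', j', \<tau>') \<in> P" "ereal (p j') \<le> \<tau>'"
    using assms(3) unfolding first_success_def by blast
  have 1: "t = t'"
    using a b assms(2,3) unfolding first_success_def by fastforce
  have pos: "0 < \<tau>" "0 < \<tau>'"
    using a b assms(1) unfolding valid_plan_def by auto
  have "\<not> ereal t + \<tau> \<le> ereal t" "\<not> ereal t + \<tau>' \<le> ereal t"
    using pos by (cases \<tau>; cases \<tau>'; simp)+
  then have "(t, j, \<tau>) = (t', j', \<tau>')"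
    using a b assms(1) 1 unfolding valid_plan_def by fastforce
  then show ?thesis by simp
qed

lemma run_ConsD:
  assumes "run A p (x # h)"
  shows "run A p h \<and> (\<exists>t j. x = (j, t + p j) \<and> first_success p (A h) t j)"
  using assms by (cases rule: run.cases) auto

lemma run_unique:
  assumes "kill_restart_strategy n A"
  shows "run A p h \<Longrightarrow> run A p h' \<Longrightarrow> length h = length h' \<Longrightarrow> h = h'"
proof (induction h arbitrary: h')
  case Nil
  then show ?case by simp
next
  case (Cons x h)
  then obtain x' g where h': "h' = x' # g" by (cases h') auto
  have "h = g"
    using Cons.IH Cons.prems run_ConsD h' by auto
  moreover have "x = x'"
    using run_ConsD[OF Cons.prems(1)] run_ConsD[of A p x' g] Cons.prems(2) h' \<open>h = g\<close>
      first_success_unique assms unfolding kill_restart_strategy_def by blast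
  ultimately show ?case using h' by simp
qed

lemma run_suffix: "run A p (k @ h) \<Longrightarrow> run A p h"
  by (induction k) (auto dest: run_ConsD)

lemma run_subset:
  assumes "kill_restart_strategy n A" "run A p h" "run A p h'" "length h \<le> length h'"
  shows "set h \<subseteq> set h'"
proof -
  let ?m = "length h' - length h"
  have "run A p (drop ?m h')"
    using run_suffix[of A p "take ?m h'" "drop ?m h'"] assms(3) by simp
  then have "h = drop ?m h'"
    using run_unique[OF assms(1,2)] assms(4) by simp
  then show ?thesis by (metis set_drop_subset)
qed

lemma run_join:
  assumes "kill_restart_strategy n A" "run A p h" "run A p h'"
  obtains g where "run A p g" "set h \<subseteq> set g" "set h' \<subseteq> set g"
proof (cases "length h \<le> length h'")
  case True
  then show ?thesis using that[OF assms(3)] run_subset[OF assms] by simp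
next
  case False
  then show ?thesis using that[OF assms(2)] run_subset[OF assms(1,3,2)] by simp
qed

text \<open>The total completion time when the jobs \<open>rev js\<close> are processed in order without idling.\<close>

primrec order_cost :: "(nat \<Rightarrow> real) \<Rightarrow> nat list \<Rightarrow> real" where
  "order_cost p [] = 0"
| "order_cost p (j # js) = sum_list (map p (j # js)) + order_cost p js"

lemma run_props:
  assumes "kill_restart_strategy n A"
  shows "run A p h \<Longrightarrow> distinct (map fst h) \<and> fst ` set h \<subseteq> {..<n} \<and>
    sum_list (map p (map fst h)) \<le> now h \<and> order_cost p (map fst h) \<le> sum_list (map snd h)"
proof (induction rule: run.induct)
  case start
  then show ?case by (simp add: now_def)
next
  case (complete h t j)
  obtain \<tau> where "(t, j, \<tau>) \<in> A h"
    using complete(2) unfolding first_success_def by blast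
  then have "j < n \<and> j \<notin> fst ` set h \<and> now h \<le> t"
    using assms unfolding kill_restart_strategy_def valid_plan_def by blast
  then show ?case using complete.IH by (auto simp: now_def)
qed

lemma completion_time_eq:
  assumes "kill_restart_strategy n A" "run A p h" "(j, C) \<in> set h"
  shows "completion_time A p j = ereal C"
proof -
  have "C' = C" if "run A p h'" "(j, C') \<in> set h'" for h' C'
  proof -
    obtain g where g: "run A p g" "set h \<subseteq> set g" "set h' \<subseteq> set g"
      using run_join[OF assms(1,2) \<open>run A p h'\<close>] .
    then have "distinct (map fst g)" "(j, C) \<in> set g" "(j, C') \<in> set g"
      using run_props[OF assms(1) g(1)] assms(3) that(2) by auto
    then show ?thesis using eq_key_imp_eq_value by fastforce
  qed
  then have "{ereal C | C. \<exists>h. run A p h \<and> (j, C) \<in> set h} = {ereal C}"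
    using assms by blast
  then show ?thesis by (simp add: completion_time_def)
qed

lemma cost_eq:
  assumes "kill_restart_strategy n A" "run A p h" "fst ` set h = {..<n}"
  shows "cost n A p = ereal (sum_list (map snd h))"
proof -
  have d: "distinct (map fst h)" using run_props[OF assms(1,2)] by simp
  have "cost n A p = (\<Sum>j\<in>set (map fst h). completion_time A p j)"
    using assms(3) by (simp add: cost_def)
  also have "\<dots> = sum_list (map (completion_time A p) (map fst h))"
    using d by (rule sum.distinct_set_conv_list)
  also have "\<dots> = sum_list (map (\<lambda>x. ereal (snd x)) h)"
    using completion_time_eq[OF assms(1,2)] unfolding map_map
    by (intro arg_cong[where f = sum_list] map_cong) auto
  also have "\<dots> = ereal (sum_list (map snd h))"
    by (induction h) auto
  finally show ?thesis .
qed

lemma cost_finite_run: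
  assumes A: "kill_restart_strategy n A" and "cost n A p < \<infinity>" "is_instance n p"
  shows "\<exists>h. run A p h \<and> fst ` set h = {..<n}"
proof -
  have "\<exists>h C. run A p h \<and> (j, C) \<in> set h" if j: "j < n" for j
  proof (rule ccontr)
    assume "\<not> ?thesis"
    then have "{ereal C | C. \<exists>h. run A p h \<and> (j, C) \<in> set h} = {}" by auto
    then have "completion_time A p j = \<infinity>"
      unfolding completion_time_def by (simp only: Inf_empty top_ereal_def)
    then have "cost n A p = \<infinity>"
      using j unfolding cost_def by (subst sum_Pinfty) auto
    then show False using assms(2) by simp
  qed
  then have "\<forall>j. \<exists>h. j < n \<longrightarrow> run A p h \<and> j \<in> fst ` set h"
    by (metis fst_conv image_eqI)
  then obtain f where f: "\<And>j. j < n \<Longrightarrow> run A p (f j) \<and> j \<in> fst ` set (f j)"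
    by metis
  have "m \<le> n \<Longrightarrow> \<exists>h. run A p h \<and> {..<m} \<subseteq> fst ` set h" for m
  proof (induction m)
    case 0
    then show ?case using run.start by auto
  next
    case (Suc m)
    then obtain h where h: "run A p h" "{..<m} \<subseteq> fst ` set h" by auto
    obtain g where "run A p g" "set h \<subseteq> set g" "set (f m) \<subseteq> set g"
      using run_join[OF A h(1)] f[of m] Suc.prems by (metis Suc_le_lessD)
    then have "fst ` set h \<subseteq> fst ` set g" "fst ` set (f m) \<subseteq> fst ` set g"
      by (simp_all add: image_mono)
    then have "{..<Suc m} \<subseteq> fst ` set g"
      using h(2) f[of m] Suc.prems by (auto simp only: lessThan_Suc)
    then show ?case using \<open>run A p g\<close> by blast
  qed
  then obtain h where "run A p h" "{..<n} \<subseteq> fst ` set h" by blast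
  then show ?thesis using run_props[OF A, of p h] by blast
qed

lemma order_cost_move:
  "(\<And>x. x \<in> set a \<Longrightarrow> p x \<le> p y) \<Longrightarrow> order_cost p (y # a @ b) \<le> order_cost p (a @ y # b)"
proof (induction a)
  case Nil
  then show ?case by simp
next
  case (Cons x a)
  then have "order_cost p (y # a @ b) \<le> order_cost p (a @ y # b)" "p x \<le> p y" by auto
  then show ?case by simp
qed

lemma order_cost_sorted:
  "distinct ys \<Longrightarrow> distinct js \<Longrightarrow> set ys = set js \<Longrightarrow> sorted_wrt (\<lambda>i j. p j \<le> p i) ys
    \<Longrightarrow> order_cost p ys \<le> order_cost p js"
proof (induction ys arbitrary: js)
  case Nil
  then show ?case by simp
next
  case (Cons y ys)
  then obtain a b where js: "js = a @ y # b"
    by (metis list.set_intros(1) split_list)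
  have s: "set ys = set (a @ b)" "distinct (a @ b)"
    using Cons.prems js by auto
  have "order_cost p ys \<le> order_cost p (a @ b)"
    using Cons s by simp
  moreover have "sum_list (map p ys) = sum_list (map p (a @ b))"
    using s Cons.prems(1) by (metis distinct.simps(2) sum.distinct_set_conv_list)
  ultimately have "order_cost p (y # ys) \<le> order_cost p (y # a @ b)" by simp
  also have "\<dots> \<le> order_cost p js"
    unfolding js using Cons.prems(4) s(1) by (intro order_cost_move) auto
  finally show ?case .
qed

definition order_strategy :: "nat \<Rightarrow> nat list \<Rightarrow> strategy" where
  "order_strategy n js h =
     (if length h < n \<and> js ! length h < n \<and> js ! length h \<notin> fst ` set h
      then {(now h, js ! length h, \<infinity>)} else {})"

lemma order_strategy: "kill_restart_strategy n (order_strategy n js)"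
  by (auto simp: kill_restart_strategy_def valid_plan_def order_strategy_def)

lemma order_strategy_run:
  assumes "distinct js" "set js = {..<n}" "k \<le> n"
  shows "\<exists>h. run (order_strategy n js) p h \<and> map fst h = rev (take k js) \<and>
    now h = sum_list (map p (map fst h)) \<and> sum_list (map snd h) = order_cost p (map fst h)"
  using assms(3)
proof (induction k)
  case 0
  then show ?case by (auto intro!: exI[of _ "[]"] run.start simp: now_def)
next
  case (Suc k)
  then obtain h where h: "run (order_strategy n js) p h" "map fst h = rev (take k js)"
    "now h = sum_list (map p (map fst h))" "sum_list (map snd h) = order_cost p (map fst h)"
    using Suc_leD by blast
  have len: "length js = n" using assms(1,2) distinct_card by fastforce
  have lh: "length h = k" using arg_cong[OF h(2), of length] len Suc.prems by simp
  have k: "k < n" using Suc.prems by simp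
  have fs: "fst ` set h = set (take k js)"
    using arg_cong[OF h(2), of set] by simp
  have "js ! k \<notin> set (take k js)"
    using assms(1) len k by (auto simp: in_set_conv_nth nth_eq_iff_index_eq)
  moreover have "js ! k < n" using assms(2) len k nth_mem by fastforce
  ultimately have "order_strategy n js h = {(now h, js ! k, \<infinity>)}"
    using lh k fs by (simp add: order_strategy_def)
  then have "first_success p (order_strategy n js h) (now h) (js ! k)"
    by (simp add: first_success_def)
  then have "run (order_strategy n js) p ((js ! k, now h + p (js ! k)) # h)"
    using h(1) run.complete by blast
  then show ?case
    using h k len
    by (intro exI[of _ "(js ! k, now h + p (js ! k)) # h"])
       (simp add: take_Suc_conv_app_nth now_def)
qed

lemma OPT_le_order_cost:
  assumes "distinct js" "set js = {..<n}"
  shows "OPT n p \<le> ereal (order_cost p (rev js))"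
proof -
  have len: "length js = n" using assms distinct_card by fastforce
  obtain h where h: "run (order_strategy n js) p h" "map fst h = rev js"
    "sum_list (map snd h) = order_cost p (map fst h)"
    using order_strategy_run[OF assms, of n p] len by auto
  have "fst ` set h = {..<n}" using arg_cong[OF h(2), of set] assms by simp
  then have "cost n (order_strategy n js) p = ereal (order_cost p (rev js))"
    using cost_eq[OF order_strategy h(1)] h by simp
  then show ?thesis
    unfolding OPT_def using order_strategy by (metis INF_lower mem_Collect_eq)
qed

lemma order_cost_rev: "order_cost p (rev js) = (\<Sum>i<length js. \<Sum>k\<le>i. p (js ! k))"
proof (induction js rule: rev_induct)
  case Nil
  then show ?case by simp
next
  case (snoc x js)
  have "sum_list (map p js) = (\<Sum>k<length js. p (js ! k))"
    by (simp add: sum_list_sum_nth atLeast0LessThan)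
  moreover have "(\<Sum>k\<le>length js. p ((js @ [x]) ! k)) = (\<Sum>k<length js. p (js ! k)) + p x"
    by (simp add: lessThan_Suc_atMost[symmetric] nth_append)
  moreover have "(\<Sum>i<length js. \<Sum>k\<le>i. p ((js @ [x]) ! k)) = (\<Sum>i<length js. \<Sum>k\<le>i. p (js ! k))"
    by (intro sum.cong) (auto simp: nth_append)
  moreover have "sum_list (map p (rev js)) = sum_list (map p js)"
    by (metis rev_map sum_list_rev)
  ultimately show ?case using snoc by simp
qed

lemma OPT_eq_SPT:
  assumes p: "is_instance n p" and js: "distinct js" "set js = {..<n}" "sorted (map p js)"
  shows "OPT n p = ereal (\<Sum>i<n. \<Sum>k\<le>i. p (js ! k))"
proof -
  have len: "length js = n" using js distinct_card by fastforce
  have "ereal (order_cost p (rev js)) \<le> cost n A p" if A: "kill_restart_strategy n A" for A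
  proof (cases "cost n A p < \<infinity>")
    case True
    then obtain h where h: "run A p h" "fst ` set h = {..<n}"
      using cost_finite_run[OF A] p by blast
    have "sorted_wrt (\<lambda>i j. p j \<le> p i) (rev js)"
      using js(3) by (simp add: sorted_wrt_rev sorted_map)
    then have "order_cost p (rev js) \<le> order_cost p (map fst h)"
      using js h run_props[OF A h(1)] by (intro order_cost_sorted) auto
    also have "\<dots> \<le> sum_list (map snd h)" using run_props[OF A h(1)] by simp
    finally show ?thesis using cost_eq[OF A h] by simp
  qed simp
  then have "ereal (order_cost p (rev js)) \<le> OPT n p"
    unfolding OPT_def by (intro INF_greatest) auto
  then show ?thesis
    using OPT_le_order_cost[OF js(1,2), of p] order_cost_rev[of p js] len by simp
qed

end

theory Submission
  imports Defs
begin

text \<open>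
  Consider the plan made at time 0 and pretend that all its probings fail. If it contains no
  infinite probing, there are arbitrarily late times \<open>T\<close> at which no probing is running. Make every
  job slightly longer than its longest probing before \<open>T\<close>. The total processing time is then about
  at most \<open>T\<close>, so \<open>OPT\<close> is at most about \<open>(n + 1) T / 2\<close>, whereas at time \<open>T\<close> everything is still
  to be done: the strategy pays at least \<open>n T + OPT\<close>. If there is an infinite probing of a job, this
  job is made very long and delays all \<open>n\<close> completions, and the ratio tends to \<open>n\<close>, which exceeds
  the bound for \<open>n \<ge> 3\<close>.
\<close>

section \<open>Order costs and upper bounds on \<open>OPT\<close>\<close>

lemma order_cost_snoc: "order_cost p (xs @ [x]) = order_cost p xs + (real (length xs) + 1) * p x"
  by (induction xs) (simp_all add: algebra_simps)

text \<open>The job at index \<open>k\<close> counts \<open>k + 1\<close> times in one order and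
  \<open>length xs - k\<close> times in the opposite one.\<close>

lemma order_cost_plus_rev:
  "order_cost p xs + order_cost p (rev xs) = (real (length xs) + 1) * sum_list (map p xs)"
proof (induction xs)
  case (Cons x xs)
  have "order_cost p (rev (x # xs)) = order_cost p (rev xs) + (real (length xs) + 1) * p x"
    by (simp add: order_cost_snoc)
  then show ?case using Cons by (simp add: distrib_left distrib_right)
qed simp

lemma order_cost_cong: "(\<And>x. x \<in> set xs \<Longrightarrow> p x = q x) \<Longrightarrow> order_cost p xs = order_cost q xs"
proof (induction xs)
  case (Cons x xs)
  have "map p (x # xs) = map q (x # xs)" using Cons.prems by (intro map_cong) auto
  then show ?case using Cons by (simp del: list.map map_eq_conv)
qed simp

lemma is_instance_ge_1:
  assumes "\<forall>j<n. 1 \<le> p j"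
  shows "is_instance n p"
  unfolding is_instance_def
proof (intro allI impI)
  fix j assume "j < n"
  then have "1 \<le> p j" using assms by blast
  then show "0 < p j" by linarith
qed

lemma valid_plan_disjoint:
  assumes "valid_plan n h P" "(t, j, \<tau>) \<in> P" "(t', j', \<tau>') \<in> P" "(t, j, \<tau>) \<noteq> (t', j', \<tau>')"
  shows "ereal t + \<tau> \<le> ereal t' \<or> ereal t' + \<tau>' \<le> ereal t"
proof -
  have "\<forall>(t, j, \<tau>) \<in> P. \<forall>(t', j', \<tau>') \<in> P. (t, j, \<tau>) \<noteq> (t', j', \<tau>') \<longrightarrow>
      ereal t + \<tau> \<le> ereal t' \<or> ereal t' + \<tau>' \<le> ereal t"
    using assms(1) by (simp add: valid_plan_def)
  from bspec[OF this assms(2)] have "\<forall>(t', j', \<tau>') \<in> P. (t, j, \<tau>) \<noteq> (t', j', \<tau>') \<longrightarrow>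
      ereal t + \<tau> \<le> ereal t' \<or> ereal t' + \<tau>' \<le> ereal t"
    by simp
  from bspec[OF this assms(3)] show ?thesis using assms(4) by simp
qed

lemma OPT_real:
  assumes "is_instance n p"
  obtains r where "OPT n p = ereal r" "0 \<le> r"
proof -
  define js where "js = sort_key p [0..<n]"
  have js: "distinct js" "set js = {..<n}" "sorted (map p js)" "length js = n"
    by (auto simp: js_def)
  have "p (js ! k) > 0" if "k < n" for k
    using that js(2,4) assms nth_mem[of k js] by (auto simp: is_instance_def)
  then have "0 \<le> (\<Sum>i<n. \<Sum>k\<le>i. p (js ! k))"
    by (intro sum_nonneg) (auto intro!: less_imp_le)
  then show ?thesis
    using that OPT_eq_SPT[OF assms js(1-3)] by blast
qed

text \<open>\<open>OPT\<close> is at most the cost of any order and of its reverse, hence at most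
  their average.\<close>

lemma OPT_le_average: "OPT n p \<le> ereal ((real n + 1) / 2 * (\<Sum>j<n. p j))"
proof -
  have "OPT n p \<le> ereal (order_cost p (rev [0..<n]))" "OPT n p \<le> ereal (order_cost p [0..<n])"
    using OPT_le_order_cost[of "[0..<n]" n p] OPT_le_order_cost[of "rev [0..<n]" n p]
    by (auto simp: atLeast0LessThan)
  moreover have "order_cost p [0..<n] + order_cost p (rev [0..<n]) = (real n + 1) * (\<Sum>j<n. p j)"
    using order_cost_plus_rev[of p "[0..<n]"]
    by (simp add: interv_sum_list_conv_sum_set_nat atLeast0LessThan)
  ultimately show ?thesis
    by (cases "OPT n p") auto
qed

section \<open>Lower bounds on the cost of a strategy\<close>

text \<open>The run lags by at least \<open>T\<close> behind processing the same jobs in completion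
  order without idling. The empty history is exempt because \<open>now []\<close> is 0.\<close>

lemma run_delayed_start:
  assumes A: "kill_restart_strategy n A"
    and start: "\<And>t j. first_success p (A []) t j \<Longrightarrow> T \<le> t"
  shows "run A p h \<Longrightarrow> (h \<noteq> [] \<longrightarrow> T + sum_list (map p (map fst h)) \<le> now h) \<and>
    real (length h) * T + order_cost p (map fst h) \<le> sum_list (map snd h)"
proof (induction rule: run.induct)
  case start
  then show ?case by simp
next
  case (complete h t j)
  obtain \<tau> where "(t, j, \<tau>) \<in> A h"
    using complete(2) unfolding first_success_def by blast
  then have "now h \<le> t"
    using A unfolding kill_restart_strategy_def valid_plan_def by blast
  moreover have "h = [] \<Longrightarrow> T \<le> t"
    using complete(2) start by blast
  ultimately have "T + sum_list (map p (map fst h)) \<le> t"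
    using complete.IH by (cases "h = []") auto
  then show ?case using complete.IH by (auto simp: now_def algebra_simps)
qed

text \<open>No completion precedes the first one, so a lower bound on the first holds for all of
  them.\<close>

lemma run_late_completions:
  assumes A: "kill_restart_strategy n A" and p: "is_instance n p"
    and start: "\<And>t j. first_success p (A []) t j \<Longrightarrow> L \<le> t + p j"
  shows "run A p h \<Longrightarrow> (h \<noteq> [] \<longrightarrow> L \<le> now h) \<and> real (length h) * L \<le> sum_list (map snd h)"
proof (induction rule: run.induct)
  case start
  then show ?case by simp
next
  case (complete h t j)
  obtain \<tau> where "(t, j, \<tau>) \<in> A h"
    using complete(2) unfolding first_success_def by blast
  then have "now h \<le> t" "j < n"
    using A unfolding kill_restart_strategy_def valid_plan_def by blast+
  moreover have "h = [] \<Longrightarrow> L \<le> t + p j"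
    using complete(2) start by blast
  moreover have "0 < p j" using p \<open>j < n\<close> by (simp add: is_instance_def)
  ultimately have "L \<le> t + p j"
    using complete.IH by (cases "h = []") auto
  then show ?case using complete.IH by (auto simp: now_def algebra_simps)
qed

lemma cost_cases:
  assumes A: "kill_restart_strategy n A" and p: "is_instance n p"
  obtains "cost n A p = \<infinity>"
  | h where "run A p h" "distinct (map fst h)" "fst ` set h = {..<n}" "length h = n"
      "cost n A p = ereal (sum_list (map snd h))"
proof (cases "cost n A p < \<infinity>")
  case True
  then obtain h where h: "run A p h" "fst ` set h = {..<n}"
    using cost_finite_run[OF A] p by blast
  have "distinct (map fst h)" using run_props[OF A h(1)] by simp
  moreover from this have "length h = n"
    using h(2) distinct_card by (metis card_lessThan length_map list.set_map)
  ultimately show ?thesis using that(2) h cost_eq[OF A h] by blast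
qed (use that in auto)

lemma cost_ge_delayed_start:
  assumes A: "kill_restart_strategy n A" and p: "is_instance n p"
    and start: "\<And>t j. first_success p (A []) t j \<Longrightarrow> T \<le> t"
  shows "ereal (real n * T) + OPT n p \<le> cost n A p"
  using A p
proof (cases rule: cost_cases)
  case (2 h)
  \<comment> \<open>The completion order is available to the clairvoyant optimum too;
    \<open>rev\<close> is needed since histories list the latest job first.\<close>
  have "OPT n p \<le> ereal (order_cost p (map fst h))"
    using OPT_le_order_cost[of "rev (map fst h)" n p] 2 by simp
  then have "ereal (real n * T) + OPT n p \<le> ereal (real n * T) + ereal (order_cost p (map fst h))"
    by (rule add_left_mono)
  also have "\<dots> \<le> cost n A p"
    using run_delayed_start[OF A start 2(1)] 2 by simp
  finally show ?thesis .
qed simp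

lemma cost_ge_late_completions:
  assumes A: "kill_restart_strategy n A" and p: "is_instance n p"
    and start: "\<And>t j. first_success p (A []) t j \<Longrightarrow> L \<le> t + p j"
  shows "ereal (real n * L) \<le> cost n A p"
  using A p
proof (cases rule: cost_cases)
  case (2 h)
  then show ?thesis using run_late_completions[OF A p start 2(1)] by simp
qed simp

section \<open>Probings in the initial plan\<close>

text \<open>Induction in order of starting points: all other intervals end before the last one
  starts, so they fit into the time up to \<open>s y\<close>.\<close>

lemma sum_disjoint_intervals_le:
  fixes s d :: "'a \<Rightarrow> real"
  assumes "finite F" "\<And>i. i \<in> F \<Longrightarrow> 0 \<le> s i \<and> 0 < d i \<and> s i + d i \<le> T" "0 \<le> T"
    and "\<And>i j. i \<in> F \<Longrightarrow> j \<in> F \<Longrightarrow> i \<noteq> j \<Longrightarrow> s i + d i \<le> s j \<or> s j + d j \<le> s i"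
  shows "sum d F \<le> T"
  using assms
proof (induction F arbitrary: T rule: finite_ranking_induct[where f = s])
  case empty
  then show ?case by simp
next
  case (insert y F)
  show ?case
  proof (cases "y \<in> F")
    case True
    then show ?thesis using insert by (simp add: insert_absorb)
  next
    case False
    have y: "0 \<le> s y" "0 < d y" "s y + d y \<le> T" using insert.prems(1) by auto
    have "s i + d i \<le> s y" if "i \<in> F" for i
      using that False insert.prems(3)[of i y] insert.hyps(2)[of i] y by auto
    then have "sum d F \<le> s y"
      using insert.prems y by (intro insert.IH) auto
    then show ?thesis using False insert.hyps(1) y by simp
  qed
qed

text \<open>A job may have infinitely many probings ending by \<open>T\<close>, so a longest one
  need not exist; one within 1 of the supremum is chosen instead. The chosen probings are pairwise
  disjoint, which bounds their total length by \<open>T\<close>.\<close>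

lemma nearly_longest_probings:
  assumes P: "valid_plan n [] P" and T: "0 \<le> T"
  obtains d :: "nat \<Rightarrow> real" where "\<And>j. 0 \<le> d j" "(\<Sum>j<n. d j) \<le> T"
    "\<And>t j \<tau>. (t, j, \<tau>) \<in> P \<Longrightarrow> ereal t + \<tau> \<le> ereal T \<Longrightarrow> \<tau> < ereal (d j + 1)"
proof -
  define D where "D j = {x. \<exists>t. (t, j, ereal x) \<in> P \<and> t + x \<le> T}" for j
  have pos: "0 \<le> t" "0 < \<tau>" if "(t, j, \<tau>) \<in> P" for t j \<tau>
    using P that by (auto simp: valid_plan_def now_def)
  have Dle: "x \<le> T" if "x \<in> D j" for x j
    using that pos by (fastforce simp: D_def)
  then have bdd: "bdd_above (D j)" for j by (meson bdd_aboveI)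
  have "\<exists>x \<in> D j. \<forall>y \<in> D j. y < x + 1" if ne: "D j \<noteq> {}" for j
  proof -
    obtain x where "x \<in> D j" "Sup (D j) - 1 < x"
      using less_cSupD[OF ne, of "Sup (D j) - 1"] by auto
    then show ?thesis
      using cSup_upper[OF _ bdd] by (intro bexI[of _ x]) force+
  qed
  then obtain e where e: "\<And>j. D j \<noteq> {} \<Longrightarrow> e j \<in> D j \<and> (\<forall>y \<in> D j. y < e j + 1)"
    by metis
  then have "\<forall>j. \<exists>t. D j \<noteq> {} \<longrightarrow> (t, j, ereal (e j)) \<in> P \<and> t + e j \<le> T"
    unfolding D_def by blast
  then obtain s where s: "\<And>j. D j \<noteq> {} \<Longrightarrow> (s j, j, ereal (e j)) \<in> P \<and> s j + e j \<le> T"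
    by metis
  define F where "F = {j. j < n \<and> D j \<noteq> {}}"
  \<comment> \<open>A job without a probing that ends by \<open>T\<close> gets the default
    0.\<close>
  define d where "d j = (if D j = {} then 0 else e j)" for j
  have "sum e F \<le> T"
  proof (rule sum_disjoint_intervals_le[where s = s])
    show "s i + e i \<le> s j \<or> s j + e j \<le> s i" if "i \<in> F" "j \<in> F" "i \<noteq> j" for i j
    proof -
      have "(s i, i, ereal (e i)) \<in> P" "(s j, j, ereal (e j)) \<in> P"
        using that s by (auto simp: F_def)
      then have "ereal (s i) + ereal (e i) \<le> ereal (s j) \<or> ereal (s j) + ereal (e j) \<le> ereal (s i)"
        using \<open>i \<noteq> j\<close> by (intro valid_plan_disjoint[OF P]) auto
      then show ?thesis by simp
    qed
  qed (use s pos T in \<open>fastforce simp: F_def\<close>)+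
  moreover have "(\<Sum>j<n. d j) = sum e F"
    by (rule sum.mono_neutral_cong_right) (auto simp: F_def d_def)
  moreover have "0 \<le> d j" for j
    using s[of j] pos(2)[of "s j" j "ereal (e j)"] by (cases "D j = {}") (auto simp: d_def)
  moreover have "\<tau> < ereal (d j + 1)" if a: "(t, j, \<tau>) \<in> P" "ereal t + \<tau> \<le> ereal T" for t j \<tau>
  proof -
    obtain x where x: "\<tau> = ereal x" using a pos(2)[OF a(1)] by (cases \<tau>) auto
    then have "x \<in> D j" using a by (auto simp: D_def)
    then show ?thesis using e[of j] x by (auto simp: d_def)
  qed
  ultimately show ?thesis using that[of d] by simp
qed

text \<open>If a probing is running across time \<open>B\<close>, it is finite and disjoint from all
  others, so its end can serve as \<open>T\<close>; otherwise \<open>B\<close> itself can.\<close>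

lemma late_pause:
  assumes P: "valid_plan n h P" and fin: "\<And>t j. (t, j, \<infinity>) \<notin> P"
  obtains T where "B \<le> T" "\<And>t j \<tau>. (t, j, \<tau>) \<in> P \<Longrightarrow> t < T \<Longrightarrow> ereal t + \<tau> \<le> ereal T"
proof (cases "\<forall>(t, j, \<tau>) \<in> P. t < B \<longrightarrow> ereal t + \<tau> \<le> ereal B")
  case True
  then show ?thesis using that[of B] by blast
next
  case False
  then obtain t j \<tau> where a: "(t, j, \<tau>) \<in> P" "t < B" "\<not> ereal t + \<tau> \<le> ereal B" by auto
  have "0 < \<tau>" using P a by (auto simp: valid_plan_def)
  then obtain x where x: "\<tau> = ereal x" "0 < x" using a(1) fin by (cases \<tau>) auto
  have "ereal t' + \<tau>' \<le> ereal (t + x)" if b: "(t', j', \<tau>') \<in> P" "t' < t + x" for t' j' \<tau>'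
  proof (cases "(t, j, \<tau>) = (t', j', \<tau>')")
    case False
    then have "ereal t + \<tau> \<le> ereal t' \<or> ereal t' + \<tau>' \<le> ereal t"
      by (rule valid_plan_disjoint[OF P a(1) b(1)])
    then show ?thesis
    proof
      assume "ereal t' + \<tau>' \<le> ereal t"
      also have "\<dots> \<le> ereal (t + x)" using x by simp
      finally show ?thesis .
    qed (use x b in simp)
  qed (use x in auto)
  then show ?thesis using that[of "t + x"] a x by simp
qed

section \<open>The two adversarial instances\<close>

lemma bad_instance_no_infinite_probing:
  assumes n: "0 < n" and A: "kill_restart_strategy n A"
    and c: "1 \<le> c" "c < 3 - 2 / (real n + 1)" and fin: "\<And>t j. (t, j, \<infinity>) \<notin> A []"
  shows "\<exists>p. (\<forall>j<n. 1 \<le> p j) \<and> ereal c * OPT n p < cost n A p"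
proof -
  have P: "valid_plan n [] (A [])" using A by (simp add: kill_restart_strategy_def)
  \<comment> \<open>It suffices that \<open>(c - 1) * OPT < n * T\<close>. As \<open>OPT\<close>
    will be at most \<open>(n + 1) / 2 * (T + n)\<close>, the left side is at most
    \<open>a * (T + n)\<close>. The hypothesis on \<open>c\<close> says exactly that
    \<open>a < n\<close>.\<close>
  define a where "a = (c - 1) * (real n + 1) / 2"
  have "(c - 1) * (real n + 1) < (2 - 2 / (real n + 1)) * (real n + 1)"
    using c by (intro mult_strict_right_mono) auto
  also have "\<dots> = 2 * real n" by (simp add: field_simps)
  finally have a: "0 \<le> a" "a < real n" using c by (simp_all add: a_def)
  \<comment> \<open>The threshold solves \<open>a * (T + n) < n * T\<close> for
    \<open>T\<close>.\<close>
  obtain T where T: "a * real n / (real n - a) + 1 \<le> T"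
    "\<And>t j \<tau>. (t, j, \<tau>) \<in> A [] \<Longrightarrow> t < T \<Longrightarrow> ereal t + \<tau> \<le> ereal T"
    using late_pause[OF P fin] by blast
  have "a * real n / (real n - a) < T" using T(1) by simp
  then have aT: "a * (T + real n) < real n * T" using a by (simp add: field_simps)
  have "0 \<le> a * real n / (real n - a)" using a by simp
  then have T0: "0 \<le> T" using T(1) by linarith
  obtain d where d: "\<And>j. 0 \<le> d j" "(\<Sum>j<n. d j) \<le> T"
    "\<And>t j \<tau>. (t, j, \<tau>) \<in> A [] \<Longrightarrow> ereal t + \<tau> \<le> ereal T \<Longrightarrow> \<tau> < ereal (d j + 1)"
    using nearly_longest_probings[OF P T0] by blast
  \<comment> \<open>The added 1 makes every probing that ends by \<open>T\<close> fail and yields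
    \<open>1 \<le> p j\<close>; it raises the total processing time by only \<open>n\<close>, which
    a large \<open>T\<close> absorbs.\<close>
  define p where "p j = d j + 1" for j
  have p1: "1 \<le> p j" for j using d(1)[of j] by (simp add: p_def)
  then have p: "is_instance n p" by (simp add: is_instance_ge_1)
  obtain r where r: "OPT n p = ereal r" "0 \<le> r" using OPT_real[OF p] .
  have "T \<le> t" if fs: "first_success p (A []) t j" for t j
  proof (rule ccontr)
    assume "\<not> T \<le> t"
    moreover obtain \<tau> where "(t, j, \<tau>) \<in> A []" "ereal (p j) \<le> \<tau>"
      using fs unfolding first_success_def by blast
    ultimately show False using T(2)[of t j \<tau>] d(3)[of t j \<tau>] by (simp add: p_def)
  qed
  from cost_ge_delayed_start[OF A p this]
  have "ereal (real n * T + r) \<le> cost n A p" by (simp add: r)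
  moreover have "c * r < real n * T + r"
  proof -
    have "(\<Sum>j<n. p j) \<le> T + real n" using d(2) by (simp add: p_def sum.distrib)
    then have "(real n + 1) / 2 * (\<Sum>j<n. p j) \<le> (real n + 1) / 2 * (T + real n)"
      by (rule mult_left_mono) simp
    moreover have "r \<le> (real n + 1) / 2 * (\<Sum>j<n. p j)"
      using OPT_le_average[of n p] r by simp
    ultimately have "r \<le> (real n + 1) / 2 * (T + real n)" by (rule order_trans[rotated])
    then have "(c - 1) * r \<le> (c - 1) * ((real n + 1) / 2 * (T + real n))"
      using c by (intro mult_left_mono) auto
    also have "\<dots> = a * (T + real n)" by (simp add: a_def)
    finally show ?thesis using aT by (simp add: algebra_simps)
  qed
  then have "ereal c * OPT n p < ereal (real n * T + r)" by (simp add: r)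
  ultimately have "ereal c * OPT n p < cost n A p" by (rule less_le_trans[rotated])
  then show ?thesis using p1 by blast
qed

text \<open>All other probings end by \<open>t0\<close> and fail, so job \<open>i\<close> completes
  first and, having length \<open>M\<close>, delays all \<open>n\<close> completions to at least
  \<open>M\<close>. Running \<open>i\<close> last costs \<open>M + K\<close> with \<open>K\<close>
  independent of \<open>M\<close>.\<close>

lemma bad_instance_infinite_probing:
  assumes A: "kill_restart_strategy n A" and c: "1 \<le> c" "c < real n" and inf: "(t0, i, \<infinity>) \<in> A []"
  shows "\<exists>p. (\<forall>j<n. 1 \<le> p j) \<and> ereal c * OPT n p < cost n A p"
proof -
  have P: "valid_plan n [] (A [])" using A by (simp add: kill_restart_strategy_def)
  have i: "i < n" "0 \<le> t0" using P inf by (auto simp: valid_plan_def now_def)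
  obtain d where d: "\<And>j. 0 \<le> d j" "(\<Sum>j<n. d j) \<le> t0"
    "\<And>t j \<tau>. (t, j, \<tau>) \<in> A [] \<Longrightarrow> ereal t + \<tau> \<le> ereal t0 \<Longrightarrow> \<tau> < ereal (d j + 1)"
    using nearly_longest_probings[OF P i(2)] by blast
  define q where "q j = d j + 1" for j
  define os where "os = filter (\<lambda>j. j \<noteq> i) [0..<n]"
  define K where "K = sum_list (map q os) + order_cost q os"
  \<comment> \<open>The second argument solves \<open>c * (M + K) < n * M\<close> for
    \<open>M\<close>; the first keeps job \<open>i\<close> longer than its own probings that end by
    \<open>t0\<close>.\<close>
  define M where "M = max (q i) (c * K / (real n - c) + 1)"
  define p where "p = q(i := M)"
  have qp: "q j \<le> p j" for j by (simp add: p_def M_def)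
  have p1: "1 \<le> p j" for j using d(1)[of j] qp[of j] by (simp add: q_def)
  then have p: "is_instance n p" by (simp add: is_instance_ge_1)
  have cM: "c * (M + K) < real n * M"
  proof -
    have "c * K / (real n - c) < M" by (simp add: M_def less_max_iff_disj)
    then show ?thesis using c by (simp add: field_simps)
  qed
  have os: "\<And>x. x \<in> set os \<Longrightarrow> p x = q x" "distinct os" "set os = {..<n} - {i}"
    by (auto simp: os_def p_def)
  \<comment> \<open>The list in \<open>order_cost\<close> runs from last to first, so its head
    \<open>i\<close> is processed last.\<close>
  have "OPT n p \<le> ereal (order_cost p (rev (rev (i # os))))"
    using os i by (intro OPT_le_order_cost) auto
  also have "order_cost p (rev (rev (i # os))) = M + K"
    using order_cost_cong[of os p q] map_cong[OF refl, of os p q] os(1)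
    by (simp add: K_def p_def del: map_eq_conv)
  finally have "OPT n p \<le> ereal (M + K)" .
  then have "ereal c * OPT n p \<le> ereal c * ereal (M + K)"
    using c by (intro ereal_mult_left_mono) auto
  also have "\<dots> < ereal (real n * M)" using cM by simp
  also have "\<dots> \<le> cost n A p"
  proof (rule cost_ge_late_completions[OF A p])
    fix t j assume "first_success p (A []) t j"
    then obtain \<tau> where \<tau>: "(t, j, \<tau>) \<in> A []" "ereal (p j) \<le> \<tau>"
      unfolding first_success_def by blast
    have "(t, j, \<tau>) = (t0, i, \<infinity>)"
    proof (rule ccontr)
      assume "(t, j, \<tau>) \<noteq> (t0, i, \<infinity>)"
      then have "ereal t + \<tau> \<le> ereal t0 \<or> ereal t0 + \<infinity> \<le> ereal t"
        by (rule valid_plan_disjoint[OF P \<tau>(1) inf])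
      then have "\<tau> < ereal (q j)" using d(3)[OF \<tau>(1)] by (auto simp: q_def)
      also have "\<dots> \<le> ereal (p j)" using qp by simp
      finally show False using \<tau>(2) by simp
    qed
    then show "M \<le> t + p j" using i by (simp add: p_def)
  qed
  finally show ?thesis using p1 by blast
qed

theorem theorem1p1:
  fixes n :: nat and A :: strategy
  assumes "3 \<le> n" and "kill_restart_strategy n A"
  shows "ereal (3 - 2 / (real n + 1)) \<le> competitive_ratio n A \<and>
    (\<forall>c::real. c < 3 - 2 / (real n + 1) \<longrightarrow>
      (\<exists>p :: nat \<Rightarrow> real. (\<forall>j<n. 1 \<le> p j) \<and> ereal c * OPT n p < cost n A p))"
proof -
  have bad: "\<exists>p. (\<forall>j<n. 1 \<le> p j) \<and> ereal c * OPT n p < cost n A p"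
    if c: "c < 3 - 2 / (real n + 1)" for c
  proof -
    have n: "0 < 2 / (real n + 1)" "2 / (real n + 1) < 2" "3 \<le> real n"
      using assms(1) by (simp_all add: field_simps)
    \<comment> \<open>Since \<open>OPT\<close> is nonnegative, raising \<open>c\<close> to at least
      1 only strengthens the claim.\<close>
    then have m: "1 \<le> max c 1" "max c 1 < 3 - 2 / (real n + 1)"
      using c by auto
    \<comment> \<open>Here \<open>3 \<le> n\<close> enters: the bound is below 3, hence below the
      ratio \<open>n\<close> approached with an infinite probing.\<close>
    with n have "max c 1 < real n" by linarith
    obtain p where p: "\<forall>j<n. 1 \<le> p j" "ereal (max c 1) * OPT n p < cost n A p"
      using bad_instance_no_infinite_probing[OF _ assms(2) m(1,2)]
        bad_instance_infinite_probing[OF assms(2) m(1) \<open>max c 1 < real n\<close>] assms(1)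
      by (metis less_le_trans zero_less_numeral)
    have "is_instance n p" using p(1) by (rule is_instance_ge_1)
    then obtain r where "OPT n p = ereal r" "0 \<le> r" by (rule OPT_real)
    then have "ereal c * OPT n p \<le> ereal (max c 1) * OPT n p"
      by (simp add: mult_right_mono del: ereal_max)
    then show ?thesis using p by (meson le_less_trans)
  qed
  moreover have "ereal (3 - 2 / (real n + 1)) \<le> competitive_ratio n A"
    unfolding competitive_ratio_def
  proof (rule Inf_greatest, clarify)
    fix c assume comp: "competitive n c A"
    show "ereal (3 - 2 / (real n + 1)) \<le> ereal c"
    proof (rule ccontr)
      assume "\<not> ?thesis"
      then obtain p where p: "\<forall>j<n. 1 \<le> p j" "ereal c * OPT n p < cost n A p"
        using bad[of c] by auto
      from p(1) have "is_instance n p" by (rule is_instance_ge_1)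
      then show False using comp p(2) unfolding competitive_def by (meson not_le)
    qed
  qed
  ultimately show ?thesis by blast
qed

end
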